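(* Given any weak 2-group $C$, it can be improved to a coherent 2-group $\mathrm{imp}(C)$ by equipping each object with an adjoint equivalence. That is: if $C$ is a weak 2-group, then for every object $x\in C$ there can be chosen an adjoint equivalence $(x,\bar{x},i_x,e_x)$ in $C$, so that the weak monoidal category $C$ together with these choices is a coherent 2-group.
   Context: A weak monoidal category is a category $M$ with a functor $\otimes\colon M\times M\to M$, an object $1\in M$, and natural isomorphisms $a_{x,y,z}\colon (x\otimes y)\otimes z\to x\otimes(y\otimes z)$, $\ell_x\colon 1\otimes x\to x$, $r_x\colon x\otimes 1\to x$ satisfying Mac Lane's pentagon and triangle identities (i.e. a monoidal category in the usual, not necessarily strict, sense). A weak inverse of an object $x$ of a weak monoidal category is an object $y$ such that $x\otimes y\cong 1$ and $y\otimes x\cong 1$; if such a $y$ exists, $x$ is called weakly invertible. A weak 2-group is a weak monoidal category in which all objects are weakly invertible and all morphisms are invertible. An adjunction in a weak monoidal category is a quadruple $(x,\bar{x},i_x,e_x)$ where $x,\bar x$ are objects and $i_x\colon 1\to x\otimes\bar{x}$ (the unit) and $e_x\colon \bar{x}\otimes x\to 1$ (the counit) are morphisms satisfying the two zig-zag identities: (1) the composite $1\otimes x \xrightarrow{i_x\otimes 1} (x\otimes\bar{x})\otimes x \xrightarrow{a_{x,\bar{x},x}} x\otimes(\bar{x}\otimes x)\xrightarrow{1\otimes e_x} x\otimes 1$ equals the composite $1\otimes x\xrightarrow{\ell_x} x\xrightarrow{r_x^{-1}} x\otimes 1$; (2) the composite $\bar{x}\otimes 1\xrightarrow{1\otimes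 i_x}\bar{x}\otimes(x\otimes\bar{x})\xrightarrow{a^{-1}_{\bar{x},x,\bar{x}}}(\bar{x}\otimes x)\otimes\bar{x}\xrightarrow{e_x\otimes 1}1\otimes\bar{x}$ equals the composite $\bar{x}\otimes 1\xrightarrow{r_{\bar{x}}}\bar{x}\xrightarrow{\ell_{\bar{x}}^{-1}}1\otimes\bar{x}$. An adjoint equivalence is an adjunction whose unit and counit are both invertible. A coherent 2-group is a weak monoidal category $C$ in which every morphism is invertible and every object $x\in C$ is equipped with an adjoint equivalence $(x,\bar{x},i_x,e_x)$. *)

theory Defs
  imports Main
begin

section \<open>Categories, functors, natural isomorphisms\<close>

text \<open>
  A category lives on carrier sets of objects and arrows inside two arbitrary types; the
  operations are only constrained on those carriers. Composition is written in application
  order: \<open>g \<cdot> f\<close> is ``first \<open>f\<close>, then \<open>g\<close>''.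
\<close>

record ('o, 'm) cat_data =
  obj :: "'o set"
  arr :: "'m set"
  src :: "'m \<Rightarrow> 'o"
  tgt :: "'m \<Rightarrow> 'o"
  ident :: "'o \<Rightarrow> 'm"
  comp_arr :: "'m \<Rightarrow> 'm \<Rightarrow> 'm" (infixr \<open>\<cdot>\<index>\<close> 60)

definition in_hom :: "('o, 'm, 'z) cat_data_scheme \<Rightarrow> 'm \<Rightarrow> 'o \<Rightarrow> 'o \<Rightarrow> bool" where
  "in_hom C f x y \<longleftrightarrow> f \<in> arr C \<and> src C f = x \<and> tgt C f = y"

locale category =
  fixes C :: "('o, 'm, 'z) cat_data_scheme" (structure)
  assumes src_in_obj: "f \<in> arr C \<Longrightarrow> src C f \<in> obj C"
    and tgt_in_obj: "f \<in> arr C \<Longrightarrow> tgt C f \<in> obj C"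
    and ident_in_hom: "x \<in> obj C \<Longrightarrow> in_hom C (ident C x) x x"
    and comp_in_hom: "in_hom C f x y \<Longrightarrow> in_hom C g y z \<Longrightarrow> in_hom C (g \<cdot> f) x z"
    and comp_ident_right: "in_hom C f x y \<Longrightarrow> f \<cdot> ident C x = f"
    and comp_ident_left: "in_hom C f x y \<Longrightarrow> ident C y \<cdot> f = f"
    and comp_assoc: "in_hom C f w x \<Longrightarrow> in_hom C g x y \<Longrightarrow> in_hom C h y z
      \<Longrightarrow> (h \<cdot> g) \<cdot> f = h \<cdot> (g \<cdot> f)"

definition inverse_arrows :: "('o, 'm, 'z) cat_data_scheme \<Rightarrow> 'm \<Rightarrow> 'm \<Rightarrow> bool" where
  "inverse_arrows C f g \<longleftrightarrow> f \<in> arr C \<and> in_hom C g (tgt C f) (src C f)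
     \<and> comp_arr C g f = ident C (src C f) \<and> comp_arr C f g = ident C (tgt C f)"

definition iso_arr :: "('o, 'm, 'z) cat_data_scheme \<Rightarrow> 'm \<Rightarrow> bool" where
  "iso_arr C f \<longleftrightarrow> (\<exists>g. inverse_arrows C f g)"

text \<open>Meaningful only for isomorphisms; the inverse is then unique.\<close>

definition inv_arr :: "('o, 'm, 'z) cat_data_scheme \<Rightarrow> 'm \<Rightarrow> 'm" where
  "inv_arr C f = (THE g. inverse_arrows C f g)"

definition iso_objs :: "('o, 'm, 'z) cat_data_scheme \<Rightarrow> 'o \<Rightarrow> 'o \<Rightarrow> bool" where
  "iso_objs C x y \<longleftrightarrow> (\<exists>f. in_hom C f x y \<and> iso_arr C f)"

definition prod_cat :: "('a, 'b, 'y) cat_data_scheme \<Rightarrow> ('c, 'd, 'z) cat_data_scheme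
    \<Rightarrow> ('a \<times> 'c, 'b \<times> 'd) cat_data" where
  "prod_cat C D =
    \<lparr> obj = obj C \<times> obj D,
      arr = arr C \<times> arr D,
      src = (\<lambda>(f, g). (src C f, src D g)),
      tgt = (\<lambda>(f, g). (tgt C f, tgt D g)),
      ident = (\<lambda>(x, y). (ident C x, ident D y)),
      comp_arr = (\<lambda>(f', g') (f, g). (comp_arr C f' f, comp_arr D g' g)) \<rparr>"

record ('o, 'm, 'p, 'n) functor_data =
  fobj :: "'o \<Rightarrow> 'p"
  farr :: "'m \<Rightarrow> 'n"

locale cat_functor = A: category A + B: category B
  for A :: "('o, 'm, 'y) cat_data_scheme" and B :: "('p, 'n, 'z) cat_data_scheme"
    and F :: "('o, 'm, 'p, 'n) functor_data" +
  assumes fobj_in_obj: "x \<in> obj A \<Longrightarrow> fobj F x \<in> obj B"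
    and farr_in_hom: "in_hom A f x y \<Longrightarrow> in_hom B (farr F f) (fobj F x) (fobj F y)"
    and farr_ident: "x \<in> obj A \<Longrightarrow> farr F (ident A x) = ident B (fobj F x)"
    and farr_comp: "in_hom A f x y \<Longrightarrow> in_hom A g y z
      \<Longrightarrow> farr F (comp_arr A g f) = comp_arr B (farr F g) (farr F f)"

locale natural_iso = F: cat_functor A B F + G: cat_functor A B G
  for A :: "('o, 'm, 'y) cat_data_scheme" and B :: "('p, 'n, 'z) cat_data_scheme"
    and F G :: "('o, 'm, 'p, 'n) functor_data" and t :: "'o \<Rightarrow> 'n" +
  assumes component_in_hom: "x \<in> obj A \<Longrightarrow> in_hom B (t x) (fobj F x) (fobj G x)"
    and component_iso: "x \<in> obj A \<Longrightarrow> iso_arr B (t x)"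
    and naturality: "in_hom A f x y
      \<Longrightarrow> comp_arr B (t y) (farr F f) = comp_arr B (farr G f) (t x)"


section \<open>Weak monoidal categories\<close>

record ('o, 'm) monoidal_data = "('o, 'm) cat_data" +
  tensor :: "('o \<times> 'o, 'm \<times> 'm, 'o, 'm) functor_data"
  unit_obj :: 'o (\<open>\<one>\<index>\<close>)
  assoc :: "'o \<Rightarrow> 'o \<Rightarrow> 'o \<Rightarrow> 'm"
  lunit :: "'o \<Rightarrow> 'm"
  runit :: "'o \<Rightarrow> 'm"

text \<open>The tensor product is written \<open>\<otimes>\<close> on objects and \<open>\<odot>\<close> on arrows.\<close>

abbreviation tensor_obj :: "('o, 'm, 'z) monoidal_data_scheme \<Rightarrow> 'o \<Rightarrow> 'o \<Rightarrow> 'o"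
    (infixr \<open>\<otimes>\<index>\<close> 70) where
  "x \<otimes>\<^bsub>M\<^esub> y \<equiv> fobj (tensor M) (x, y)"

abbreviation tensor_arr :: "('o, 'm, 'z) monoidal_data_scheme \<Rightarrow> 'm \<Rightarrow> 'm \<Rightarrow> 'm"
    (infixr \<open>\<odot>\<index>\<close> 70) where
  "f \<odot>\<^bsub>M\<^esub> g \<equiv> farr (tensor M) (f, g)"

locale weak_monoidal_category = category M
  for M :: "('o, 'm, 'z) monoidal_data_scheme" (structure) +
  assumes tensor_functor: "cat_functor (prod_cat M M) M (tensor M)"
    and unit_in_obj: "\<one> \<in> obj M"
    and assoc_natural_iso: "natural_iso (prod_cat (prod_cat M M) M) M
      \<lparr> fobj = (\<lambda>((x, y), z). (x \<otimes> y) \<otimes> z), farr = (\<lambda>((f, g), h). (f \<odot> g) \<odot> h) \<rparr>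
      \<lparr> fobj = (\<lambda>((x, y), z). x \<otimes> (y \<otimes> z)), farr = (\<lambda>((f, g), h). f \<odot> (g \<odot> h)) \<rparr>
      (\<lambda>((x, y), z). assoc M x y z)"
    and lunit_natural_iso: "natural_iso M M
      \<lparr> fobj = (\<lambda>x. \<one> \<otimes> x), farr = (\<lambda>f. ident M \<one> \<odot> f) \<rparr>
      \<lparr> fobj = (\<lambda>x. x), farr = (\<lambda>f. f) \<rparr>
      (lunit M)"
    and runit_natural_iso: "natural_iso M M
      \<lparr> fobj = (\<lambda>x. x \<otimes> \<one>), farr = (\<lambda>f. f \<odot> ident M \<one>) \<rparr>
      \<lparr> fobj = (\<lambda>x. x), farr = (\<lambda>f. f) \<rparr>
      (runit M)"
    and pentagon: "w \<in> obj M \<Longrightarrow> x \<in> obj M \<Longrightarrow> y \<in> obj M \<Longrightarrow> z \<in> obj M \<Longrightarrow>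
      assoc M w x (y \<otimes> z) \<cdot> assoc M (w \<otimes> x) y z =
      (ident M w \<odot> assoc M x y z) \<cdot> assoc M w (x \<otimes> y) z \<cdot> (assoc M w x y \<odot> ident M z)"
    and triangle: "x \<in> obj M \<Longrightarrow> y \<in> obj M \<Longrightarrow>
      (ident M x \<odot> lunit M y) \<cdot> assoc M x \<one> y = runit M x \<odot> ident M y"


section \<open>Weak 2-groups\<close>

definition weak_inverse :: "('o, 'm, 'z) monoidal_data_scheme \<Rightarrow> 'o \<Rightarrow> 'o \<Rightarrow> bool" where
  "weak_inverse M x y \<longleftrightarrow> y \<in> obj M
     \<and> iso_objs M (x \<otimes>\<^bsub>M\<^esub> y) \<one>\<^bsub>M\<^esub> \<and> iso_objs M (y \<otimes>\<^bsub>M\<^esub> x) \<one>\<^bsub>M\<^esub>"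

definition weakly_invertible :: "('o, 'm, 'z) monoidal_data_scheme \<Rightarrow> 'o \<Rightarrow> bool" where
  "weakly_invertible M x \<longleftrightarrow> (\<exists>y. weak_inverse M x y)"

locale weak_2_group = weak_monoidal_category M
  for M :: "('o, 'm, 'z) monoidal_data_scheme" (structure) +
  assumes objects_weakly_invertible: "x \<in> obj M \<Longrightarrow> weakly_invertible M x"
    and arrows_invertible: "f \<in> arr M \<Longrightarrow> iso_arr M f"


section \<open>Adjoint equivalences and coherent 2-groups\<close>

definition adjunction ::
    "('o, 'm, 'z) monoidal_data_scheme \<Rightarrow> 'o \<Rightarrow> 'o \<Rightarrow> 'm \<Rightarrow> 'm \<Rightarrow> bool" where
  "adjunction M x x' i e \<longleftrightarrow>
     x \<in> obj M \<and> x' \<in> obj M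
     \<and> in_hom M i \<one>\<^bsub>M\<^esub> (x \<otimes>\<^bsub>M\<^esub> x') \<and> in_hom M e (x' \<otimes>\<^bsub>M\<^esub> x) \<one>\<^bsub>M\<^esub>
     \<and> (ident M x \<odot>\<^bsub>M\<^esub> e) \<cdot>\<^bsub>M\<^esub> assoc M x x' x \<cdot>\<^bsub>M\<^esub> (i \<odot>\<^bsub>M\<^esub> ident M x)
         = inv_arr M (runit M x) \<cdot>\<^bsub>M\<^esub> lunit M x
     \<and> (e \<odot>\<^bsub>M\<^esub> ident M x') \<cdot>\<^bsub>M\<^esub> inv_arr M (assoc M x' x x') \<cdot>\<^bsub>M\<^esub> (ident M x' \<odot>\<^bsub>M\<^esub> i)
         = inv_arr M (lunit M x') \<cdot>\<^bsub>M\<^esub> runit M x'"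

definition adjoint_equivalence ::
    "('o, 'm, 'z) monoidal_data_scheme \<Rightarrow> 'o \<Rightarrow> 'o \<Rightarrow> 'm \<Rightarrow> 'm \<Rightarrow> bool" where
  "adjoint_equivalence M x x' i e \<longleftrightarrow> adjunction M x x' i e \<and> iso_arr M i \<and> iso_arr M e"

record ('o, 'm) coherent_data = "('o, 'm) monoidal_data" +
  dual :: "'o \<Rightarrow> 'o"
  adj_unit :: "'o \<Rightarrow> 'm"
  adj_counit :: "'o \<Rightarrow> 'm"

locale coherent_2_group = weak_monoidal_category C
  for C :: "('o, 'm, 'z) coherent_data_scheme" (structure) +
  assumes arrows_invertible: "f \<in> arr C \<Longrightarrow> iso_arr C f"
    and equipped: "x \<in> obj C
      \<Longrightarrow> adjoint_equivalence C x (dual C x) (adj_unit C x) (adj_counit C x)"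

text \<open>The same monoidal category, with a chosen dual, unit and counit for each object.\<close>

definition equip :: "('o, 'm) monoidal_data \<Rightarrow> ('o \<Rightarrow> 'o) \<Rightarrow> ('o \<Rightarrow> 'm) \<Rightarrow> ('o \<Rightarrow> 'm)
    \<Rightarrow> ('o, 'm) coherent_data" where
  "equip C d i e = monoidal_data.extend C (coherent_data.fields d i e)"

end

theory Submission
  imports Defs
begin

text \<open>
  Let \<open>y\<close> be a weak inverse of \<open>x\<close> and \<open>i : \<one> \<rightarrow> x \<otimes> y\<close> an isomorphism. The functor \<open>x \<otimes> -\<close> is
  fully faithful, because \<open>y \<otimes> (x \<otimes> -)\<close> and \<open>x \<otimes> (y \<otimes> -)\<close> are isomorphic to the identity.
  Fullness gives a morphism \<open>e : y \<otimes> x \<rightarrow> \<one>\<close> satisfying the first zig-zag identity, since that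
  identity prescribes \<open>1 \<odot> e\<close>. The second one can be checked after applying \<open>x \<otimes> -\<close>, where it
  follows from the first one, the interchange law and the invertibility of \<open>i\<close>.
\<close>

section \<open>Isomorphisms and cancellation in a category\<close>

context category
begin

lemma arr_obj [simp]: "f \<in> arr C \<Longrightarrow> src C f \<in> obj C" "f \<in> arr C \<Longrightarrow> tgt C f \<in> obj C"
  by (simp_all add: src_in_obj tgt_in_obj)

lemma ident_simps [simp]:
  assumes "x \<in> obj C"
  shows "ident C x \<in> arr C" "src C (ident C x) = x" "tgt C (ident C x) = x"
  using ident_in_hom[OF assms] by (simp_all add: in_hom_def)

lemma comp_simps [simp]:
  assumes "f \<in> arr C" "g \<in> arr C" "src C g = tgt C f"
  shows "g \<cdot> f \<in> arr C" "src C (g \<cdot> f) = src C f" "tgt C (g \<cdot> f) = tgt C g"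
  using comp_in_hom[of f "src C f" "tgt C f" g "tgt C g"] assms by (simp_all add: in_hom_def)

lemma comp_ident_simps [simp]:
  "f \<in> arr C \<Longrightarrow> src C f = x \<Longrightarrow> f \<cdot> ident C x = f"
  "f \<in> arr C \<Longrightarrow> tgt C f = x \<Longrightarrow> ident C x \<cdot> f = f"
  using comp_ident_right[of f x "tgt C f"] comp_ident_left[of f "src C f" x]
  by (simp_all add: in_hom_def)

lemma comp_assoc_arr:
  assumes "f \<in> arr C" "g \<in> arr C" "h \<in> arr C" "src C g = tgt C f" "src C h = tgt C g"
  shows "(h \<cdot> g) \<cdot> f = h \<cdot> g \<cdot> f"
  using comp_assoc[of f "src C f" "tgt C f" g "tgt C g" h "tgt C h"] assms
  by (simp add: in_hom_def)

lemma inverse_arrows_unique: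
  assumes "inverse_arrows C f g" "inverse_arrows C f h"
  shows "g = h"
proof -
  have "g = (h \<cdot> f) \<cdot> g"
    using assms by (simp add: inverse_arrows_def in_hom_def)
  also have "\<dots> = h \<cdot> f \<cdot> g"
    using assms by (intro comp_assoc_arr) (auto simp: inverse_arrows_def in_hom_def)
  also have "\<dots> = h"
    using assms by (simp add: inverse_arrows_def in_hom_def)
  finally show ?thesis .
qed

text \<open>Uniqueness of two-sided inverses makes the definite description in
  \<open>inv_arr\<close> denote one; all later reasoning about inverses rests on this.\<close>

lemma inverse_arrows_inv_arr:
  assumes "iso_arr C f"
  shows "inverse_arrows C f (inv_arr C f)"
proof -
  obtain g where "inverse_arrows C f g"
    using assms by (auto simp: iso_arr_def)
  then show ?thesis
    unfolding inv_arr_def by (rule theI) (use \<open>inverse_arrows C f g\<close> inverse_arrows_unique in blast)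
qed

lemma inv_simps [simp]:
  assumes "iso_arr C f"
  shows "f \<in> arr C" "inv_arr C f \<in> arr C"
    "src C (inv_arr C f) = tgt C f" "tgt C (inv_arr C f) = src C f"
    "inv_arr C f \<cdot> f = ident C (src C f)" "f \<cdot> inv_arr C f = ident C (tgt C f)"
  using inverse_arrows_inv_arr[OF assms] by (simp_all add: inverse_arrows_def in_hom_def)

lemma iso_inv: "iso_arr C f \<Longrightarrow> iso_arr C (inv_arr C f)"
  unfolding iso_arr_def[of C "inv_arr C f"] inverse_arrows_def
  by (rule exI[of _ f]) (simp add: in_hom_def)

lemma iso_comp:
  assumes "iso_arr C f" "iso_arr C g" "src C g = tgt C f"
  shows "iso_arr C (g \<cdot> f)"
proof -
  have "inv_arr C f \<cdot> inv_arr C g \<cdot> g \<cdot> f = ident C (src C f)"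
    using assms by (simp flip: comp_assoc_arr[of f g "inv_arr C g"])
  moreover have "g \<cdot> f \<cdot> inv_arr C f \<cdot> inv_arr C g = ident C (tgt C g)"
    using assms by (simp flip: comp_assoc_arr[of "inv_arr C g" "inv_arr C f" f])
  ultimately show ?thesis
    unfolding iso_arr_def inverse_arrows_def using assms
    by (intro exI[of _ "inv_arr C f \<cdot> inv_arr C g"]) (simp add: in_hom_def comp_assoc_arr)
qed

lemma iso_cancel_right:
  assumes "g \<cdot> f = h \<cdot> f" "iso_arr C f" "g \<in> arr C" "h \<in> arr C"
    "src C g = tgt C f" "src C h = tgt C f"
  shows "g = h"
proof -
  have "(g \<cdot> f) \<cdot> inv_arr C f = (h \<cdot> f) \<cdot> inv_arr C f"
    using assms(1) by simp
  then show ?thesis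
    using assms(2-) by (simp add: comp_assoc_arr)
qed

lemma iso_cancel_left:
  assumes "f \<cdot> g = f \<cdot> h" "iso_arr C f" "g \<in> arr C" "h \<in> arr C"
    "tgt C g = src C f" "tgt C h = src C f"
  shows "g = h"
proof -
  have "inv_arr C f \<cdot> f \<cdot> g = inv_arr C f \<cdot> f \<cdot> h"
    using assms(1) by simp
  then show ?thesis
    using assms(2-) by (simp flip: comp_assoc_arr)
qed

lemma comp_inv_cancel [simp]:
  assumes "iso_arr C f" "g \<in> arr C"
  shows "tgt C g = src C f \<Longrightarrow> inv_arr C f \<cdot> f \<cdot> g = g"
    "tgt C g = tgt C f \<Longrightarrow> f \<cdot> inv_arr C f \<cdot> g = g"
  using assms by (simp_all flip: comp_assoc_arr)

end

section \<open>The monoidal structure in pointwise form\<close>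

context weak_monoidal_category
begin

lemma unit_obj [simp]: "\<one> \<in> obj M"
  by (rule unit_in_obj)

lemma tensor_obj_in_obj [simp]: "x \<in> obj M \<Longrightarrow> y \<in> obj M \<Longrightarrow> x \<otimes> y \<in> obj M"
  using cat_functor.fobj_in_obj[OF tensor_functor, of "(x, y)"] by (simp add: prod_cat_def)

lemma tensor_arr_simps [simp]:
  assumes "f \<in> arr M" "g \<in> arr M"
  shows "f \<odot> g \<in> arr M" "src M (f \<odot> g) = src M f \<otimes> src M g"
    "tgt M (f \<odot> g) = tgt M f \<otimes> tgt M g"
  using cat_functor.farr_in_hom[OF tensor_functor, of "(f, g)" "(src M f, src M g)" "(tgt M f, tgt M g)"]
    assms by (simp_all add: prod_cat_def in_hom_def)

lemma tensor_ident [simp]: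
  "x \<in> obj M \<Longrightarrow> y \<in> obj M \<Longrightarrow> ident M x \<odot> ident M y = ident M (x \<otimes> y)"
  using cat_functor.farr_ident[OF tensor_functor, of "(x, y)"] by (simp add: prod_cat_def)

lemma interchange:
  assumes "f \<in> arr M" "g \<in> arr M" "h \<in> arr M" "k \<in> arr M" "src M g = tgt M f" "src M k = tgt M h"
  shows "(g \<odot> k) \<cdot> (f \<odot> h) = (g \<cdot> f) \<odot> (k \<cdot> h)"
  using cat_functor.farr_comp[OF tensor_functor, of "(f, h)" "(src M f, src M h)"
      "(tgt M f, tgt M h)" "(g, k)" "(tgt M g, tgt M k)"]
    assms by (simp add: prod_cat_def in_hom_def)

lemma iso_tensor:
  assumes "iso_arr M f" "iso_arr M g"
  shows "iso_arr M (f \<odot> g)"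
  unfolding iso_arr_def inverse_arrows_def using assms
  by (intro exI[of _ "inv_arr M f \<odot> inv_arr M g"]) (simp add: in_hom_def interchange)

lemma iso_ident: "x \<in> obj M \<Longrightarrow> iso_arr M (ident M x)"
  unfolding iso_arr_def inverse_arrows_def
  by (intro exI[of _ "ident M x"]) (simp add: in_hom_def)

lemma assoc_simps [simp]:
  assumes "x \<in> obj M" "y \<in> obj M" "z \<in> obj M"
  shows "assoc M x y z \<in> arr M" "src M (assoc M x y z) = (x \<otimes> y) \<otimes> z"
    "tgt M (assoc M x y z) = x \<otimes> y \<otimes> z" "iso_arr M (assoc M x y z)"
  using natural_iso.component_in_hom[OF assoc_natural_iso, of "((x, y), z)"]
    natural_iso.component_iso[OF assoc_natural_iso, of "((x, y), z)"] assms
  by (simp_all add: prod_cat_def in_hom_def)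

lemma lunit_simps [simp]:
  assumes "x \<in> obj M"
  shows "lunit M x \<in> arr M" "src M (lunit M x) = \<one> \<otimes> x" "tgt M (lunit M x) = x"
    "iso_arr M (lunit M x)"
  using natural_iso.component_in_hom[OF lunit_natural_iso, of x]
    natural_iso.component_iso[OF lunit_natural_iso, of x] assms
  by (simp_all add: in_hom_def)

lemma runit_simps [simp]:
  assumes "x \<in> obj M"
  shows "runit M x \<in> arr M" "src M (runit M x) = x \<otimes> \<one>" "tgt M (runit M x) = x"
    "iso_arr M (runit M x)"
  using natural_iso.component_in_hom[OF runit_natural_iso, of x]
    natural_iso.component_iso[OF runit_natural_iso, of x] assms
  by (simp_all add: in_hom_def)

lemma assoc_natural:
  assumes "f \<in> arr M" "g \<in> arr M" "h \<in> arr M"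
    and "src M f = x" "src M g = y" "src M h = z" "tgt M f = x'" "tgt M g = y'" "tgt M h = z'"
  shows "assoc M x' y' z' \<cdot> ((f \<odot> g) \<odot> h) = (f \<odot> g \<odot> h) \<cdot> assoc M x y z"
  using natural_iso.naturality[OF assoc_natural_iso, of "((f, g), h)" "((x, y), z)" "((x', y'), z')"]
    assms by (simp add: prod_cat_def in_hom_def)

lemma lunit_natural:
  "f \<in> arr M \<Longrightarrow> src M f = x \<Longrightarrow> tgt M f = y \<Longrightarrow> lunit M y \<cdot> (ident M \<one> \<odot> f) = f \<cdot> lunit M x"
  using natural_iso.naturality[OF lunit_natural_iso, of f x y] by (simp add: in_hom_def)

lemma runit_natural:
  "f \<in> arr M \<Longrightarrow> src M f = x \<Longrightarrow> tgt M f = y \<Longrightarrow> runit M y \<cdot> (f \<odot> ident M \<one>) = f \<cdot> runit M x"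
  using natural_iso.naturality[OF runit_natural_iso, of f x y] by (simp add: in_hom_def)

section \<open>Kelly's coherence identities for the unit constraints\<close>

text \<open>Naturality of \<open>lunit\<close> expresses \<open>f\<close> precomposed with an
  isomorphism through \<open>ident M \<one> \<odot> f\<close>, so the latter determines
  \<open>f\<close>. Equations may thus be checked after tensoring with the unit, which makes the
  pentagon and triangle applicable.\<close>

lemma unit_tensor_faithful:
  assumes "ident M \<one> \<odot> f = ident M \<one> \<odot> g" "f \<in> arr M" "g \<in> arr M"
    "src M f = src M g" "tgt M f = tgt M g"
  shows "f = g"
proof (rule iso_cancel_right)
  show "f \<cdot> lunit M (src M f) = g \<cdot> lunit M (src M f)"
    using assms lunit_natural[of f] lunit_natural[of g] by metis
qed (use assms in simp_all)

lemma tensor_unit_faithful: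
  assumes "f \<odot> ident M \<one> = g \<odot> ident M \<one>" "f \<in> arr M" "g \<in> arr M"
    "src M f = src M g" "tgt M f = tgt M g"
  shows "f = g"
proof (rule iso_cancel_right)
  show "f \<cdot> runit M (src M f) = g \<cdot> runit M (src M f)"
    using assms runit_natural[of f] runit_natural[of g] by metis
qed (use assms in simp_all)

text \<open>Tensor with \<open>\<one>\<close> on the left and precompose with the isomorphism
  \<open>?t\<close>. The pentagon for \<open>(\<one>, \<one>, x, y)\<close> and the triangle then
  turn both sides into the same arrow, built from \<open>runit M \<one>\<close>.\<close>

lemma lunit_tensor:
  assumes "x \<in> obj M" "y \<in> obj M"
  shows "lunit M (x \<otimes> y) \<cdot> assoc M \<one> x y = lunit M x \<odot> ident M y"
proof -
  let ?I = "ident M \<one>" and ?a = "assoc M"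
  note [simp] = assms iso_ident
  \<comment> \<open>\<open>?t\<close> consists of the first two arrows on the three-arrow side of
    that pentagon; the remaining one is \<open>?I \<odot> ?a \<one> x y\<close>.\<close>
  let ?t = "?a \<one> (\<one> \<otimes> x) y \<cdot> (?a \<one> \<one> x \<odot> ident M y)"
  have "(?I \<odot> (lunit M (x \<otimes> y) \<cdot> ?a \<one> x y)) \<cdot> ?t
      = (?I \<odot> lunit M (x \<otimes> y)) \<cdot> (?I \<odot> ?a \<one> x y) \<cdot> ?t"
    by (simp add: interchange flip: comp_assoc_arr)
  also have "\<dots> = (?I \<odot> lunit M (x \<otimes> y)) \<cdot> ?a \<one> \<one> (x \<otimes> y) \<cdot> ?a (\<one> \<otimes> \<one>) x y"
    by (simp add: pentagon)
  also have "\<dots> = (runit M \<one> \<odot> ident M (x \<otimes> y)) \<cdot> ?a (\<one> \<otimes> \<one>) x y"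
    by (simp add: triangle flip: comp_assoc_arr)
  also have "\<dots> = ?a \<one> x y \<cdot> ((runit M \<one> \<odot> ident M x) \<odot> ident M y)"
    by (subst assoc_natural[where x="\<one> \<otimes> \<one>" and y=x and z=y]) simp_all
  also have "\<dots> = ?a \<one> x y \<cdot> ((?I \<odot> lunit M x) \<odot> ident M y) \<cdot> (?a \<one> \<one> x \<odot> ident M y)"
    by (simp add: triangle interchange)
  also have "\<dots> = (?I \<odot> lunit M x \<odot> ident M y) \<cdot> ?t"
    by (simp add: assoc_natural[where x=\<one> and y="\<one> \<otimes> x" and z=y] flip: comp_assoc_arr)
  finally have "(?I \<odot> (lunit M (x \<otimes> y) \<cdot> ?a \<one> x y)) = (?I \<odot> lunit M x \<odot> ident M y)"
    by (rule iso_cancel_right) (simp_all add: iso_comp iso_tensor)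
  then show ?thesis
    by (rule unit_tensor_faithful) simp_all
qed

text \<open>The mirror argument: tensor with \<open>\<one>\<close> on the right, postcompose with an
  associator, and use the pentagon for \<open>(x, y, \<one>, \<one>)\<close> with the triangles for
  \<open>(y, \<one>)\<close> and \<open>(x \<otimes> y, \<one>)\<close>.\<close>

lemma runit_tensor:
  assumes "x \<in> obj M" "y \<in> obj M"
  shows "(ident M x \<odot> runit M y) \<cdot> assoc M x y \<one> = runit M (x \<otimes> y)"
proof -
  let ?I = "ident M \<one>" and ?a = "assoc M"
  note [simp] = assms
  have "?a x y \<one> \<cdot> (((ident M x \<odot> runit M y) \<cdot> ?a x y \<one>) \<odot> ?I)
      = ?a x y \<one> \<cdot> ((ident M x \<odot> runit M y) \<odot> ?I) \<cdot> (?a x y \<one> \<odot> ?I)"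
    by (simp add: interchange)
  also have "\<dots> = (ident M x \<odot> runit M y \<odot> ?I) \<cdot> ?a x (y \<otimes> \<one>) \<one> \<cdot> (?a x y \<one> \<odot> ?I)"
    by (simp add: assoc_natural[where x=x and y="y \<otimes> \<one>" and z=\<one>] flip: comp_assoc_arr)
  also have "\<dots> = (ident M x \<odot> ident M y \<odot> lunit M \<one>) \<cdot> (ident M x \<odot> ?a y \<one> \<one>)
      \<cdot> ?a x (y \<otimes> \<one>) \<one> \<cdot> (?a x y \<one> \<odot> ?I)"
    by (simp add: interchange triangle flip: comp_assoc_arr)
  also have "\<dots> = (ident M x \<odot> ident M y \<odot> lunit M \<one>) \<cdot> ?a x y (\<one> \<otimes> \<one>) \<cdot> ?a (x \<otimes> y) \<one> \<one>"
    by (simp add: pentagon)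
  \<comment> \<open>\<open>tensor_ident\<close> is disabled here because naturality of the
    associator needs the two identities as separate factors.\<close>
  also have "\<dots> = ?a x y \<one> \<cdot> ((ident M x \<odot> ident M y) \<odot> lunit M \<one>) \<cdot> ?a (x \<otimes> y) \<one> \<one>"
    by (subst comp_assoc_arr[symmetric], simp_all del: tensor_ident,
        subst assoc_natural[where x=x and y=y and z="\<one> \<otimes> \<one>" and x'=x and y'=y and z'=\<one>, symmetric],
        simp_all add: comp_assoc_arr)
  also have "\<dots> = ?a x y \<one> \<cdot> (runit M (x \<otimes> y) \<odot> ?I)"
    by (simp add: triangle)
  finally have "((ident M x \<odot> runit M y) \<cdot> ?a x y \<one>) \<odot> ?I = runit M (x \<otimes> y) \<odot> ?I"
    by (rule iso_cancel_left) simp_all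
  then show ?thesis
    by (rule tensor_unit_faithful) simp_all
qed

text \<open>Naturality of \<open>lunit\<close> at \<open>lunit M \<one>\<close> identifies
  \<open>lunit M (\<one> \<otimes> \<one>)\<close> with
  \<open>ident M \<one> \<odot> lunit M \<one>\<close>. Hence \<open>lunit_tensor\<close> and the
  triangle describe the same arrow, once as \<open>lunit M \<one> \<odot> ident M \<one>\<close> and
  once as \<open>runit M \<one> \<odot> ident M \<one>\<close>.\<close>

lemma lunit_eq_runit: "lunit M \<one> = runit M \<one>"
proof (rule tensor_unit_faithful)
  have "lunit M (\<one> \<otimes> \<one>) = ident M \<one> \<odot> lunit M \<one>"
    by (rule iso_cancel_left[OF lunit_natural[symmetric, of "lunit M \<one>"]]) simp_all
  then show "lunit M \<one> \<odot> ident M \<one> = runit M \<one> \<odot> ident M \<one>"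
    using lunit_tensor[of \<one> \<one>] triangle[of \<one> \<one>] by simp
qed simp_all

section \<open>Tensoring with a weakly invertible object is fully faithful\<close>

text \<open>For an isomorphism \<open>k : y \<otimes> x \<rightarrow> \<one>\<close> these are the
  components of the natural isomorphism from \<open>y \<otimes> (x \<otimes> -)\<close> to the
  identity functor.\<close>

definition contract :: "'m \<Rightarrow> 'o \<Rightarrow> 'o \<Rightarrow> 'o \<Rightarrow> 'm" where
  "contract k y x u = lunit M u \<cdot> (k \<odot> ident M u) \<cdot> inv_arr M (assoc M y x u)"

lemma contract_simps:
  assumes "in_hom M k (y \<otimes> x) \<one>" "iso_arr M k" "x \<in> obj M" "y \<in> obj M" "u \<in> obj M"
  shows "contract k y x u \<in> arr M" "src M (contract k y x u) = y \<otimes> x \<otimes> u"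
    "tgt M (contract k y x u) = u" "iso_arr M (contract k y x u)"
  using assms unfolding contract_def
  by (auto simp: in_hom_def intro!: iso_comp iso_tensor iso_inv iso_ident)

text \<open>The three factors are treated in turn: \<open>f\<close> passes the inverse associator by
  naturality, \<open>k\<close> by interchange, and \<open>lunit\<close> by naturality.\<close>

lemma contract_natural:
  assumes k: "in_hom M k (y \<otimes> x) \<one>" "iso_arr M k" and [simp]: "x \<in> obj M" "y \<in> obj M"
    and [simp]: "f \<in> arr M"
  shows "contract k y x (tgt M f) \<cdot> (ident M y \<odot> ident M x \<odot> f) = f \<cdot> contract k y x (src M f)"
proof -
  have [simp]: "k \<in> arr M" "src M k = y \<otimes> x" "tgt M k = \<one>"
    using k by (simp_all add: in_hom_def)
  let ?u = "src M f" and ?v = "tgt M f"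
  have "inv_arr M (assoc M y x ?v) \<cdot> (ident M y \<odot> ident M x \<odot> f)
      = ((ident M y \<odot> ident M x) \<odot> f) \<cdot> inv_arr M (assoc M y x ?u)"
    (is "?l = ?r")
  proof (rule iso_cancel_left)
    have "assoc M y x ?v \<cdot> ?r
        = ((ident M y \<odot> ident M x \<odot> f) \<cdot> assoc M y x ?u) \<cdot> inv_arr M (assoc M y x ?u)"
      using assoc_natural[of "ident M y" "ident M x" f y x ?u y x ?v]
      by (simp flip: comp_assoc_arr)
    then show "assoc M y x ?v \<cdot> ?l = assoc M y x ?v \<cdot> ?r"
      by (simp add: comp_assoc_arr)
  qed simp_all
  then have "contract k y x ?v \<cdot> (ident M y \<odot> ident M x \<odot> f)
      = lunit M ?v \<cdot> (k \<odot> ident M ?v) \<cdot> (ident M (y \<otimes> x) \<odot> f) \<cdot> inv_arr M (assoc M y x ?u)"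
    by (simp add: contract_def comp_assoc_arr)
  also have "\<dots> = lunit M ?v \<cdot> (ident M \<one> \<odot> f) \<cdot> (k \<odot> ident M ?u) \<cdot> inv_arr M (assoc M y x ?u)"
    by (simp add: interchange flip: comp_assoc_arr[of "inv_arr M (assoc M y x ?u)"])
  also have "\<dots> = f \<cdot> contract k y x ?u"
    by (simp add: contract_def lunit_natural comp_assoc_arr flip: comp_assoc_arr[of _ "ident M \<one> \<odot> f"])
  finally show ?thesis .
qed

lemma weak_inverse_sym: "x \<in> obj M \<Longrightarrow> weak_inverse M x y \<Longrightarrow> weak_inverse M y x"
  by (simp add: weak_inverse_def)

text \<open>By \<open>contract_natural\<close>, \<open>f\<close> is the conjugate by
  \<open>contract\<close> of \<open>ident M y \<odot> ident M x \<odot> f\<close>, which depends on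
  \<open>f\<close> only through \<open>ident M x \<odot> f\<close>.\<close>

lemma tensor_left_faithful:
  assumes xy: "x \<in> obj M" "weak_inverse M x y"
    and eq: "ident M x \<odot> f = ident M x \<odot> g"
    and f: "f \<in> arr M" "g \<in> arr M" "src M f = src M g" "tgt M f = tgt M g"
  shows "f = g"
proof -
  obtain k where k: "in_hom M k (y \<otimes> x) \<one>" "iso_arr M k" and y: "y \<in> obj M"
    using xy by (auto simp: weak_inverse_def iso_objs_def)
  have "f \<cdot> contract k y x (src M f) = g \<cdot> contract k y x (src M f)"
    using contract_natural[OF k xy(1) y f(1)] contract_natural[OF k xy(1) y f(2)] eq f by simp
  then show ?thesis
    by (rule iso_cancel_right) (use contract_simps[OF k xy(1) y] f in simp_all)
qed

lemma tensor_left_full: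
  assumes xy: "x \<in> obj M" "weak_inverse M x y"
    and uv: "u \<in> obj M" "v \<in> obj M"
    and h: "in_hom M h (x \<otimes> u) (x \<otimes> v)"
  shows "\<exists>f. in_hom M f u v \<and> ident M x \<odot> f = h"
proof -
  obtain k where k: "in_hom M k (y \<otimes> x) \<one>" "iso_arr M k" and y: "y \<in> obj M"
    using xy by (auto simp: weak_inverse_def iso_objs_def)
  note [simp] = xy(1) y uv contract_simps[OF k xy(1) y]
  have [simp]: "h \<in> arr M" "src M h = x \<otimes> u" "tgt M h = x \<otimes> v"
    using h by (simp_all add: in_hom_def)
  \<comment> \<open>If \<open>h\<close> is to be \<open>ident M x \<odot> f\<close>, naturality of
    \<open>contract\<close> leaves this conjugate as the only candidate.\<close>
  define f where "f = contract k y x v \<cdot> (ident M y \<odot> h) \<cdot> inv_arr M (contract k y x u)"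
  have f [simp]: "f \<in> arr M" "src M f = u" "tgt M f = v"
    by (simp_all add: f_def)
  have "contract k y x v \<cdot> (ident M y \<odot> ident M x \<odot> f) = f \<cdot> contract k y x u"
    using contract_natural[OF k xy(1) y f(1)] by simp
  also have "\<dots> = contract k y x v \<cdot> (ident M y \<odot> h)"
    by (simp add: f_def comp_assoc_arr)
  finally have "ident M y \<odot> ident M x \<odot> f = ident M y \<odot> h"
    by (rule iso_cancel_left) simp_all
  \<comment> \<open>The object \<open>y\<close> is weakly invertible as well, with weak inverse
    \<open>x\<close>, so \<open>y \<otimes> -\<close> is faithful and can be cancelled.\<close>
  then have "ident M x \<odot> f = h"
    by (rule tensor_left_faithful[OF y weak_inverse_sym[OF xy]]) simp_all
  then show ?thesis
    using f by (intro exI[of _ f]) (simp add: in_hom_def)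
qed

section \<open>The second zig-zag identity from the first\<close>

text \<open>
  Tensoring the second zig-zag with \<open>x\<close> on the left and precomposing it with the isomorphism
  \<open>a \<cdot> (i \<odot> 1) : \<one> \<otimes> \<one> \<rightarrow> x \<otimes> (y \<otimes> \<one>)\<close> makes it an instance of the first one, via the
  pentagon for \<open>(x, y, x, y)\<close>.
\<close>

lemma zigzag_dual:
  assumes xy: "x \<in> obj M" "weak_inverse M x y"
    and i: "in_hom M i \<one> (x \<otimes> y)" "iso_arr M i"
    and e: "in_hom M e (y \<otimes> x) \<one>"
    and zigzag: "(ident M x \<odot> e) \<cdot> assoc M x y x \<cdot> (i \<odot> ident M x)
      = inv_arr M (runit M x) \<cdot> lunit M x"
  shows "(e \<odot> ident M y) \<cdot> inv_arr M (assoc M y x y) \<cdot> (ident M y \<odot> i)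
      = inv_arr M (lunit M y) \<cdot> runit M y"
    (is "?l = ?r")
proof -
  let ?a = "assoc M" and ?x = "ident M x" and ?y = "ident M y" and ?I = "ident M \<one>"
  have y [simp]: "y \<in> obj M"
    using xy by (simp add: weak_inverse_def)
  note [simp] = xy(1) i(2) iso_ident
  have [simp]: "i \<in> arr M" "src M i = \<one>" "tgt M i = x \<otimes> y"
      "e \<in> arr M" "src M e = y \<otimes> x" "tgt M e = \<one>"
    using i e by (simp_all add: in_hom_def)
  have [simp]: "?l \<in> arr M" "src M ?l = y \<otimes> \<one>" "tgt M ?l = \<one> \<otimes> y"
      "?r \<in> arr M" "src M ?r = y \<otimes> \<one>" "tgt M ?r = \<one> \<otimes> y"
    by simp_all
  \<comment> \<open>The pentagon for \<open>(x, y, x, y)\<close>, solved for the side containing the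
    inverse associator of the second zig-zag.\<close>
  have a_inv: "(?x \<odot> inv_arr M (?a y x y)) \<cdot> ?a x y (x \<otimes> y)
      = ?a x (y \<otimes> x) y \<cdot> (?a x y x \<odot> ?y) \<cdot> inv_arr M (?a (x \<otimes> y) x y)"
  proof -
    have "((?x \<odot> inv_arr M (?a y x y)) \<cdot> ?a x y (x \<otimes> y)) \<cdot> ?a (x \<otimes> y) x y
        = (?x \<odot> inv_arr M (?a y x y)) \<cdot> (?x \<odot> ?a y x y) \<cdot> ?a x (y \<otimes> x) y \<cdot> (?a x y x \<odot> ?y)"
      by (simp add: comp_assoc_arr pentagon)
    also have "\<dots> = ?a x (y \<otimes> x) y \<cdot> (?a x y x \<odot> ?y)"
      by (subst comp_assoc_arr[symmetric]) (simp_all add: interchange)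
    also have "\<dots> = (?a x (y \<otimes> x) y \<cdot> (?a x y x \<odot> ?y) \<cdot> inv_arr M (?a (x \<otimes> y) x y))
        \<cdot> ?a (x \<otimes> y) x y"
      by (simp add: comp_assoc_arr)
    finally show ?thesis
      by (rule iso_cancel_right) simp_all
  qed
  have a_unit: "inv_arr M (?a (x \<otimes> y) x y) \<cdot> (i \<odot> ident M (x \<otimes> y))
      = ((i \<odot> ?x) \<odot> ?y) \<cdot> inv_arr M (?a \<one> x y)" (is "?p = ?q")
  proof (rule iso_cancel_left)
    have "?a (x \<otimes> y) x y \<cdot> ?q
        = ((i \<odot> ?x \<odot> ?y) \<cdot> ?a \<one> x y) \<cdot> inv_arr M (?a \<one> x y)"
      using assoc_natural[of i ?x ?y \<one> x y "x \<otimes> y" x y]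
      by (simp del: tensor_ident flip: comp_assoc_arr)
    then show "?a (x \<otimes> y) x y \<cdot> ?p = ?a (x \<otimes> y) x y \<cdot> ?q"
      by (simp add: comp_assoc_arr)
  qed simp_all
  have l_inv: "(lunit M x \<odot> ?y) \<cdot> inv_arr M (?a \<one> x y) = lunit M (x \<otimes> y)"
    by (simp flip: lunit_tensor add: comp_assoc_arr)
  \<comment> \<open>The triangle for \<open>(x, y)\<close> with both unit constraints
    inverted.\<close>
  have r_inv: "?a x \<one> y \<cdot> (inv_arr M (runit M x) \<odot> ?y) = ?x \<odot> inv_arr M (lunit M y)"
    (is "?p = ?q")
  proof (rule iso_cancel_left)
    have "(?x \<odot> lunit M y) \<cdot> ?p = (runit M x \<odot> ?y) \<cdot> (inv_arr M (runit M x) \<odot> ?y)"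
      by (subst comp_assoc_arr[symmetric]) (simp_all add: triangle)
    then show "(?x \<odot> lunit M y) \<cdot> ?p = (?x \<odot> lunit M y) \<cdot> ?q"
      by (simp add: interchange)
  qed (simp_all add: iso_tensor)
  have "?x \<odot> ?l = ?x \<odot> ?r"
  proof (rule iso_cancel_right)
    let ?s = "?a x y \<one> \<cdot> (i \<odot> ?I)"
    \<comment> \<open>After the associator is moved out, the two copies of \<open>i\<close> act on
      different tensor factors and interchange. The copy adjacent to
      \<open>?a x y (x \<otimes> y)\<close> is the one that will enter the first zig-zag.\<close>
    have "(?x \<odot> ?y \<odot> i) \<cdot> ?s = (?a x y (x \<otimes> y) \<cdot> ((?x \<odot> ?y) \<odot> i)) \<cdot> (i \<odot> ?I)"
      by (subst assoc_natural[of ?x ?y i x y \<one> x y "x \<otimes> y"]) (simp_all add: comp_assoc_arr del: tensor_ident)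
    also have "\<dots> = ?a x y (x \<otimes> y) \<cdot> (i \<odot> ident M (x \<otimes> y)) \<cdot> (?I \<odot> i)"
      by (simp add: interchange comp_assoc_arr)
    finally have 1: "(?x \<odot> ?y \<odot> i) \<cdot> ?s = \<dots>" .
    have "(?x \<odot> ?l) \<cdot> ?s = (?x \<odot> e \<odot> ?y) \<cdot> (?x \<odot> inv_arr M (?a y x y)) \<cdot> (?x \<odot> ?y \<odot> i) \<cdot> ?s"
      by (simp add: interchange flip: comp_assoc_arr)
    also have "\<dots> = (?x \<odot> e \<odot> ?y) \<cdot> ((?x \<odot> inv_arr M (?a y x y)) \<cdot> ?a x y (x \<otimes> y))
        \<cdot> (i \<odot> ident M (x \<otimes> y)) \<cdot> (?I \<odot> i)"
      unfolding 1 by (simp add: comp_assoc_arr)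
    also have "\<dots> = ((?x \<odot> e \<odot> ?y) \<cdot> ?a x (y \<otimes> x) y) \<cdot> (?a x y x \<odot> ?y)
        \<cdot> (inv_arr M (?a (x \<otimes> y) x y) \<cdot> (i \<odot> ident M (x \<otimes> y))) \<cdot> (?I \<odot> i)"
      unfolding a_inv by (simp add: comp_assoc_arr)
    also have "\<dots> = (?a x \<one> y \<cdot> ((?x \<odot> e) \<odot> ?y)) \<cdot> (?a x y x \<odot> ?y)
        \<cdot> (((i \<odot> ?x) \<odot> ?y) \<cdot> inv_arr M (?a \<one> x y)) \<cdot> (?I \<odot> i)"
      unfolding a_unit by (subst assoc_natural[of ?x e ?y x "y \<otimes> x" y x \<one> y]) simp_all
    \<comment> \<open>Functoriality of \<open>- \<otimes> y\<close>, an instance of interchange,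
      collects the three arrows of the first zig-zag in one factor.\<close>
    also have "\<dots> = ?a x \<one> y \<cdot> (((?x \<odot> e) \<cdot> ?a x y x \<cdot> (i \<odot> ?x)) \<odot> ?y)
        \<cdot> inv_arr M (?a \<one> x y) \<cdot> (?I \<odot> i)"
      by (simp add: interchange[of _ _ ?y ?y, simplified, symmetric] comp_assoc_arr)
    also have "\<dots> = ?a x \<one> y \<cdot> ((inv_arr M (runit M x) \<cdot> lunit M x) \<odot> ?y)
        \<cdot> inv_arr M (?a \<one> x y) \<cdot> (?I \<odot> i)"
      unfolding zigzag ..
    also have "\<dots> = (?a x \<one> y \<cdot> (inv_arr M (runit M x) \<odot> ?y))
        \<cdot> ((lunit M x \<odot> ?y) \<cdot> inv_arr M (?a \<one> x y)) \<cdot> (?I \<odot> i)"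
      by (simp add: interchange[of _ _ ?y ?y, simplified, symmetric] comp_assoc_arr)
    \<comment> \<open>The remaining \<open>i\<close> passes \<open>lunit\<close> by naturality,
      leaving \<open>lunit M \<one>\<close>. Since this equals \<open>runit M \<one>\<close>,
      naturality of \<open>runit\<close> can move \<open>i\<close> back, now as
      \<open>i \<odot> ?I\<close>, and \<open>?s\<close> reappears.\<close>
    also have "\<dots> = (?x \<odot> inv_arr M (lunit M y)) \<cdot> i \<cdot> runit M \<one>"
      unfolding r_inv l_inv by (simp add: lunit_natural lunit_eq_runit)
    also have "\<dots> = (?x \<odot> inv_arr M (lunit M y)) \<cdot> runit M (x \<otimes> y) \<cdot> (i \<odot> ?I)"
      by (simp add: runit_natural)
    also have "\<dots> = (?x \<odot> inv_arr M (lunit M y)) \<cdot> (?x \<odot> runit M y) \<cdot> ?s"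
      by (simp flip: runit_tensor add: comp_assoc_arr)
    also have "\<dots> = (?x \<odot> ?r) \<cdot> ?s"
      by (simp add: interchange flip: comp_assoc_arr)
    finally show "(?x \<odot> ?l) \<cdot> ?s = (?x \<odot> ?r) \<cdot> ?s" .
  qed (simp_all add: iso_comp iso_tensor)
  then show ?thesis
    by (rule tensor_left_faithful[OF xy]) simp_all
qed

end

section \<open>Adjoint equivalences in a weak 2-group\<close>

lemma (in weak_2_group) ex_adjoint_equivalence:
  assumes [simp]: "x \<in> obj M"
  shows "\<exists>y i e. adjoint_equivalence M x y i e"
proof -
  obtain y where xy: "weak_inverse M x y"
    using objects_weakly_invertible[OF assms] by (auto simp: weakly_invertible_def)
  then have [simp]: "y \<in> obj M"
    by (simp add: weak_inverse_def)
  obtain j where j: "in_hom M j (x \<otimes> y) \<one>" "iso_arr M j"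
    using xy by (auto simp: weak_inverse_def iso_objs_def)
  \<comment> \<open>Weak invertibility supplies an isomorphism into \<open>\<one>\<close>, while the
    unit of an adjunction starts there.\<close>
  define i where "i = inv_arr M j"
  have i: "in_hom M i \<one> (x \<otimes> y)" "iso_arr M i"
    using j by (simp_all add: i_def in_hom_def iso_inv)
  then have [simp]: "i \<in> arr M" "src M i = \<one>" "tgt M i = x \<otimes> y"
    by (simp_all add: in_hom_def)
  let ?s = "assoc M x y x \<cdot> (i \<odot> ident M x)"
  have s [simp]: "iso_arr M ?s" "src M ?s = \<one> \<otimes> x" "tgt M ?s = x \<otimes> y \<otimes> x"
    using i by (simp_all add: iso_comp iso_tensor iso_ident)
  \<comment> \<open>This is the first zig-zag solved for \<open>ident M x \<odot> e\<close>;
    fullness of \<open>x \<otimes> -\<close> then yields \<open>e\<close> itself.\<close>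
  have "in_hom M ((inv_arr M (runit M x) \<cdot> lunit M x) \<cdot> inv_arr M ?s) (x \<otimes> y \<otimes> x) (x \<otimes> \<one>)"
    using inv_simps[OF s(1)] by (simp add: in_hom_def)
  then obtain e where e: "in_hom M e (y \<otimes> x) \<one>"
    "ident M x \<odot> e = (inv_arr M (runit M x) \<cdot> lunit M x) \<cdot> inv_arr M ?s"
    using tensor_left_full[OF assms xy, of "y \<otimes> x" \<one>] by auto
  have zigzag: "(ident M x \<odot> e) \<cdot> ?s = inv_arr M (runit M x) \<cdot> lunit M x"
    unfolding e(2) using inv_simps[OF s(1)] by (simp add: comp_assoc_arr)
  have "adjunction M x y i e"
    unfolding adjunction_def using i(1) e(1) zigzag zigzag_dual[OF assms xy i e(1) zigzag] by simp
  then show ?thesis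
    \<comment> \<open>The counit is invertible because every arrow of a weak 2-group is.\<close>
    using i(2) e(1) arrows_invertible unfolding adjoint_equivalence_def in_hom_def by blast
qed

section \<open>Transport of the structure to the equipped record\<close>

lemma equip_simps [simp]:
  "obj (equip C d i e) = obj C" "arr (equip C d i e) = arr C"
  "src (equip C d i e) = src C" "tgt (equip C d i e) = tgt C"
  "ident (equip C d i e) = ident C" "comp_arr (equip C d i e) = comp_arr C"
  "tensor (equip C d i e) = tensor C" "unit_obj (equip C d i e) = unit_obj C"
  "assoc (equip C d i e) = assoc C" "lunit (equip C d i e) = lunit C"
  "runit (equip C d i e) = runit C" "dual (equip C d i e) = d"
  "adj_unit (equip C d i e) = i" "adj_counit (equip C d i e) = e"
  by (simp_all add: equip_def monoidal_data.defs coherent_data.defs)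

lemma equip_arrow_simps [simp]:
  "in_hom (equip C d i e) = in_hom C" "iso_arr (equip C d i e) = iso_arr C"
  "inv_arr (equip C d i e) = inv_arr C" "prod_cat (equip C d i e) A = prod_cat C A"
  "prod_cat A (equip C d i e) = prod_cat A C"
  by (simp_all add: fun_eq_iff in_hom_def iso_arr_def inv_arr_def inverse_arrows_def prod_cat_def)

text \<open>The equipped record has another type, so each locale predicate has to be carried over.
  It agrees with the old one because it reads only fields that \<open>equip\<close> leaves
  unchanged; the following lemmas use the same argument.\<close>

lemma category_equip: "category (equip C d i e) = category C"
  by (simp add: category_def)

lemma cat_functor_equip_tgt: "cat_functor A (equip C d i e) F = cat_functor A C F"
  by (simp add: cat_functor_def cat_functor_axioms_def category_equip)

lemma cat_functor_equip_src: "cat_functor (equip C d i e) A F = cat_functor C A F"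
  by (simp add: cat_functor_def cat_functor_axioms_def category_equip)

lemma natural_iso_equip_tgt: "natural_iso A (equip C d i e) F G t = natural_iso A C F G t"
  by (simp add: natural_iso_def natural_iso_axioms_def cat_functor_equip_tgt)

lemma natural_iso_equip_src: "natural_iso (equip C d i e) A F G t = natural_iso C A F G t"
  by (simp add: natural_iso_def natural_iso_axioms_def cat_functor_equip_src)

text \<open>Once products are rewritten, the tensor and the associator involve the new record only
  as target, whereas \<open>lunit\<close> and \<open>runit\<close> have it as source and target;
  hence the separate lemmas for the two sides.\<close>

lemma weak_monoidal_category_equip:
  "weak_monoidal_category (equip C d i e) = weak_monoidal_category C"
  by (simp add: weak_monoidal_category_def weak_monoidal_category_axioms_def category_equip
      cat_functor_equip_tgt natural_iso_equip_tgt natural_iso_equip_src)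

lemma adjoint_equivalence_equip:
  "adjoint_equivalence (equip C d i e) = adjoint_equivalence C"
  by (simp add: fun_eq_iff adjoint_equivalence_def adjunction_def)

theorem theorem14:
  fixes C :: "('o, 'm) monoidal_data"
  assumes "weak_2_group C"
  shows "\<exists>d i e. (\<forall>x\<in>obj C. adjoint_equivalence C x (d x) (i x) (e x))
                \<and> coherent_2_group (equip C d i e)"
proof -
  interpret weak_2_group C
    by (rule assms)
  \<comment> \<open>The axiom of choice turns the pointwise existence statement into three functions
    on objects.\<close>
  obtain d i e where equipped: "\<forall>x\<in>obj C. adjoint_equivalence C x (d x) (i x) (e x)"
    using ex_adjoint_equivalence by metis
  moreover have "coherent_2_group (equip C d i e)"
    using equipped weak_monoidal_category_axioms arrows_invertible
    by (simp add: coherent_2_group_def coherent_2_group_axioms_def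
        weak_monoidal_category_equip adjoint_equivalence_equip)
  ultimately show ?thesis
    by blast
qed

end
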